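(* For any separable metrizable space $X$ and any metrizable space $Y$, the function space $C_k(X,Y)$ is a $P^{\omega_1}_\omega$-space.
   Context: $C_k(X,Y)$ is the set of all continuous functions $X\to Y$ endowed with the compact-open topology. A point $x$ of a topological space $Z$ is a $P^{\omega_1}_\omega$-point if for any uncountable family $\mathcal U$ of neighborhoods of $x$ there is a countably infinite subfamily $\mathcal V\subset\mathcal U$ whose intersection $\bigcap\mathcal V$ is a neighborhood of $x$. A space is a $P^{\omega_1}_\omega$-space if each of its points is a $P^{\omega_1}_\omega$-point. *)

theory Defs
  imports "HOL-Analysis.Analysis"
begin

(* A continuous map between the abstract topologies X and Y is represented by its unique
   representative in extensional (topspace X), so that two elements of the set below are equal
   iff they agree on topspace X. *)
definition continuous_maps :: "'a topology \<Rightarrow> 'b topology \<Rightarrow> ('a \<Rightarrow> 'b) set" where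
  "continuous_maps X Y = {f \<in> extensional (topspace X). continuous_map X Y f}"

definition compact_open_topology :: "'a topology \<Rightarrow> 'b topology \<Rightarrow> ('a \<Rightarrow> 'b) topology" where
  "compact_open_topology X Y =
     topology_generated_by
       {{f \<in> continuous_maps X Y. f ` K \<subseteq> U} | K U. compactin X K \<and> openin Y U}"

lemma topspace_compact_open_topology [simp]:
  "topspace (compact_open_topology X Y) = continuous_maps X Y"
proof -
  have "continuous_maps X Y \<in> {{f \<in> continuous_maps X Y. f ` K \<subseteq> U} | K U. compactin X K \<and> openin Y U}"
    by (intro CollectI exI[of _ "{}"]) auto
  then show ?thesis
    unfolding compact_open_topology_def topology_generated_by_topspace by blast
qed

(* Neighbourhoods are not required to be open. *)
definition neighbourhood_in :: "'a topology \<Rightarrow> 'a \<Rightarrow> 'a set \<Rightarrow> bool" where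
  "neighbourhood_in Z x N \<longleftrightarrow> N \<subseteq> topspace Z \<and> (\<exists>U. openin Z U \<and> x \<in> U \<and> U \<subseteq> N)"

(* Families of neighbourhoods are sets of sets, i.e. without repetitions. *)
definition P_omega1_omega_point :: "'a topology \<Rightarrow> 'a \<Rightarrow> bool" where
  "P_omega1_omega_point Z x \<longleftrightarrow>
     (\<forall>\<U>. uncountable \<U> \<and> (\<forall>N\<in>\<U>. neighbourhood_in Z x N) \<longrightarrow>
        (\<exists>\<V>. \<V> \<subseteq> \<U> \<and> countable \<V> \<and> infinite \<V> \<and> neighbourhood_in Z x (\<Inter>\<V>)))"

definition P_omega1_omega_space :: "'a topology \<Rightarrow> bool" where
  "P_omega1_omega_space Z \<longleftrightarrow> (\<forall>x\<in>topspace Z. P_omega1_omega_point Z x)"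

end

theory Submission
  imports Defs
begin

text \<open>
  A neighbourhood of \<open>f\<close> in the compact-open topology contains all \<open>g\<close> that are
  \<open>\<epsilon>\<close>-close to \<open>f\<close> on some compact set \<open>K\<close>, and uncountably many members of an uncountable
  family of neighbourhoods share one \<open>\<epsilon>\<close>. Since a countable family of open sets of \<open>X\<close>
  contains neighbourhood bases of all compact sets, some member \<open>K\<^sub>0\<close> of the uncountable family of compact
  sets is a condensation point of the family in the upper Vietoris topology. So there are
  infinitely many members converging to \<open>K\<^sub>0\<close> from above; together with \<open>K\<^sub>0\<close> they have
  compact union, and \<open>\<epsilon>\<close>-closeness on this union gives a neighbourhood of \<open>f\<close>.
\<close>

section \<open>Countable bases and neighbourhoods of compact sets\<close>

lemma separable_metrizable_imp_second_countable:
  assumes "separable_space X" "metrizable_space X"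
  shows "second_countable X"
proof -
  obtain M d where "Metric_space M d" and X: "X = Metric_space.mtopology M d"
    using assms(2) metrizable_space_def by blast
  then interpret Metric_space M d by simp
  obtain C where C: "countable C" "C \<subseteq> M" "mtopology closure_of C = M"
    using assms(1) unfolding separable_space_def X by auto
  define \<B> where "\<B> = (\<lambda>(c, n). mball c (inverse (real (Suc n)))) ` (C \<times> (UNIV :: nat set))"
  have "\<exists>V\<in>\<B>. x \<in> V \<and> V \<subseteq> U" if U: "openin mtopology U" and x: "x \<in> U" for U x
  proof -
    obtain r where r: "r > 0" "mball x r \<subseteq> U"
      using U x openin_mtopology by blast
    \<comment> \<open>Half of \<open>r\<close> is used because a ball of radius
      \<open>1/(n+1)\<close> about a centre that close to \<open>x\<close> reaches at most twice
      that radius away from \<open>x\<close>.\<close>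
    obtain n where n: "inverse (real (Suc n)) < r / 2"
      using reals_Archimedean[of "r / 2"] r(1) by auto
    have "x \<in> M"
      using U x openin_mtopology by blast
    then obtain c where c: "c \<in> C" "c \<in> mball x (inverse (real (Suc n)))"
      using C(3) unfolding metric_closure_of
      by (smt (verit, best) inverse_positive_iff_positive mem_Collect_eq of_nat_0_less_iff zero_less_Suc)
    have "mball c (inverse (real (Suc n))) \<subseteq> mball x r"
      using c n by (intro mball_subset) (auto simp: commute)
    then show ?thesis
      using c r(2) unfolding \<B>_def by (auto simp: commute intro!: bexI[of _ c] exI[of _ n])
  qed
  moreover have "countable \<B>"
    unfolding \<B>_def using C(1) by simp
  moreover have "\<forall>V\<in>\<B>. openin mtopology V"
    unfolding \<B>_def by auto
  ultimately show ?thesis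
    unfolding second_countable_def X by metis
qed

text \<open>Finite unions of members of a countable base suffice: compactness selects finitely many
  base sets inside \<open>U\<close> that cover \<open>K\<close>.\<close>

lemma second_countable_compact_neighbourhoods:
  assumes "second_countable X"
  obtains \<W> where "countable \<W>" "\<And>W. W \<in> \<W> \<Longrightarrow> openin X W"
    "\<And>K U. compactin X K \<Longrightarrow> openin X U \<Longrightarrow> K \<subseteq> U \<Longrightarrow> \<exists>W\<in>\<W>. K \<subseteq> W \<and> W \<subseteq> U"
proof -
  obtain \<B> where \<B>: "countable \<B>" "\<forall>V\<in>\<B>. openin X V"
    "\<And>U x. openin X U \<Longrightarrow> x \<in> U \<Longrightarrow> \<exists>V\<in>\<B>. x \<in> V \<and> V \<subseteq> U"
    using assms unfolding second_countable_def by metis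
  show thesis
  proof
    show "countable (Union ` {\<F>. finite \<F> \<and> \<F> \<subseteq> \<B>})"
      using countable_Collect_finite_subset[OF \<B>(1)] by blast
  next
    fix W assume "W \<in> Union ` {\<F>. finite \<F> \<and> \<F> \<subseteq> \<B>}"
    then show "openin X W"
      using \<B>(2) by (auto intro: openin_Union)
  next
    fix K U assume K: "compactin X K" and U: "openin X U" "K \<subseteq> U"
    have "K \<subseteq> \<Union>{V \<in> \<B>. V \<subseteq> U}"
      using \<B>(3)[OF U(1)] U(2) by blast
    then obtain \<F> where "finite \<F>" "\<F> \<subseteq> {V \<in> \<B>. V \<subseteq> U}" "K \<subseteq> \<Union>\<F>"
      using compactinD[OF K, of "{V \<in> \<B>. V \<subseteq> U}"] \<B>(2) by blast
    then show "\<exists>W\<in>Union ` {\<F>. finite \<F> \<and> \<F> \<subseteq> \<B>}. K \<subseteq> W \<and> W \<subseteq> U"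
      by (intro bexI[of _ "\<Union>\<F>"]) auto
  qed
qed

section \<open>Sequences of compact sets with compact union\<close>

lemma inj_choice_from_infinite_sets:
  fixes S :: "nat \<Rightarrow> 'a set"
  assumes "\<And>n. infinite (S n)"
  obtains j where "inj j" "\<And>n. j n \<in> S n"
proof -
  have "\<exists>j. \<forall>n. j n \<in> S n \<and> j n \<notin> j ` {..<n}"
  \<comment> \<open>Recursion on the index: only the finitely many earlier values have to be
    avoided.\<close>
  proof (rule dependent_wf_choice[of less_than])
    fix n :: nat and f :: "nat \<Rightarrow> 'a"
    have "infinite (S n - f ` {..<n})"
      using assms by (simp add: Diff_infinite_finite)
    then show "\<exists>r. r \<in> S n \<and> r \<notin> f ` {..<n}"
      by (metis Diff_iff ex_in_conv finite.emptyI)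
  qed auto
  then obtain j where j: "\<And>n. j n \<in> S n" "\<And>n. j n \<notin> j ` {..<n}"
    by blast
  have "inj j"
    by (rule linorder_injI) (metis j(2) imageI lessThan_iff)
  with j(1) show thesis
    using that by blast
qed

text \<open>A finite subcover of \<open>K0\<close> has an open union, which already covers all but
  finitely many \<open>K n\<close>; the remaining ones have a compact union of their own.\<close>

lemma compactin_Un_upper_convergent_sequence:
  assumes K0: "compactin X K0" and K: "\<And>n::nat. compactin X (K n)"
    and conv: "\<And>U. openin X U \<Longrightarrow> K0 \<subseteq> U \<Longrightarrow> \<exists>N. \<forall>n\<ge>N. K n \<subseteq> U"
  shows "compactin X (K0 \<union> (\<Union>n. K n))"
  unfolding compactin_def
proof (intro conjI allI impI)
  show "K0 \<union> (\<Union>n. K n) \<subseteq> topspace X"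
    using K0 K compactin_subset_topspace by blast
next
  fix \<U> assume \<U>: "(\<forall>U\<in>\<U>. openin X U) \<and> K0 \<union> (\<Union>n. K n) \<subseteq> \<Union>\<U>"
  obtain \<F> where \<F>: "finite \<F>" "\<F> \<subseteq> \<U>" "K0 \<subseteq> \<Union>\<F>"
    using compactinD[OF K0, of \<U>] \<U> by blast
  have "openin X (\<Union>\<F>)"
    using \<F>(2) \<U> by blast
  then obtain N where N: "\<And>n. n \<ge> N \<Longrightarrow> K n \<subseteq> \<Union>\<F>"
    using conv \<F>(3) by blast
  have "compactin X (\<Union>n<N. K n)"
    using K by (intro compactin_Union) auto
  moreover have "(\<Union>n<N. K n) \<subseteq> \<Union>\<U>"
    using \<U> by blast
  ultimately obtain \<G> where \<G>: "finite \<G>" "\<G> \<subseteq> \<U>" "(\<Union>n<N. K n) \<subseteq> \<Union>\<G>"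
    using compactinD[of X "\<Union>n<N. K n" \<U>] \<U> by blast
  have "K n \<subseteq> \<Union>(\<F> \<union> \<G>)" for n
    using N[of n] \<G>(3) by (cases "n < N") (auto simp: not_less)
  then show "\<exists>\<F>. finite \<F> \<and> \<F> \<subseteq> \<U> \<and> K0 \<union> (\<Union>n. K n) \<subseteq> \<Union>\<F>"
    using \<F> \<G> by (intro exI[of _ "\<F> \<union> \<G>"]) blast
qed

text \<open>Indexing the compact sets allows repetitions: \<open>j\<close> is injective as a
  sequence of indices, although the sets \<open>K (j n)\<close> may coincide.\<close>

lemma uncountable_compact_family_sequence:
  assumes X: "second_countable X" and I: "uncountable I"
    and K: "\<And>i. i \<in> I \<Longrightarrow> compactin X (K i)"
  obtains j :: "nat \<Rightarrow> 'i" and L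
  where "inj j" "range j \<subseteq> I" "compactin X L" "\<And>n. K (j n) \<subseteq> L"
proof -
  obtain \<W> where \<W>: "countable \<W>" "\<And>W. W \<in> \<W> \<Longrightarrow> openin X W"
    "\<And>K U. compactin X K \<Longrightarrow> openin X U \<Longrightarrow> K \<subseteq> U \<Longrightarrow> \<exists>W\<in>\<W>. K \<subseteq> W \<and> W \<subseteq> U"
    using second_countable_compact_neighbourhoods[OF X] by blast
  \<comment> \<open>Each member of \<open>bad\<close> accounts for countably many indices, so some
    index \<open>i0\<close> survives; its set \<open>K i0\<close> is the condensation point.\<close>
  define bad where "bad = {W \<in> \<W>. countable {i \<in> I. K i \<subseteq> W}}"
  have "countable (\<Union>W\<in>bad. {i \<in> I. K i \<subseteq> W})"
    using \<W>(1) by (intro countable_UN) (auto simp: bad_def)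
  then have "\<not> I \<subseteq> (\<Union>W\<in>bad. {i \<in> I. K i \<subseteq> W})"
    using I countable_subset by blast
  then obtain i0 where i0: "i0 \<in> I" and good: "\<And>W. W \<in> \<W> \<Longrightarrow> K i0 \<subseteq> W \<Longrightarrow> W \<notin> bad"
    by blast
  define \<N> where "\<N> = {W \<in> \<W>. K i0 \<subseteq> W}"
  have "\<N> \<noteq> {}"
    using \<W>(3)[OF K[OF i0] openin_topspace compactin_subset_topspace[OF K[OF i0]]]
    unfolding \<N>_def by blast
  moreover have "countable \<N>"
    using \<W>(1) unfolding \<N>_def by simp
  ultimately obtain w :: "nat \<Rightarrow> 'a set" where w: "range w = \<N>"
    using uncountable_def by metis
  define S where "S n = {i \<in> I. \<forall>m\<le>n. K i \<subseteq> w m}" for n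
  have "infinite (S n)" for n
  proof -
    have "openin X (w m)" "K i0 \<subseteq> w m" for m
      using w \<W>(2) unfolding \<N>_def by blast+
    then have W: "openin X (\<Inter>(w ` {..n}))" "K i0 \<subseteq> \<Inter>(w ` {..n})"
      by (auto intro!: openin_Inter)
    \<comment> \<open>The finite intersection need not belong to \<open>\<W>\<close>, so a member
      \<open>V\<close> is put between it and \<open>K i0\<close>; as \<open>V\<close> is not in
      \<open>bad\<close>, it contains uncountably many \<open>K i\<close>.\<close>
    obtain V where V: "V \<in> \<W>" "K i0 \<subseteq> V" "V \<subseteq> \<Inter>(w ` {..n})"
      using \<W>(3)[OF K[OF i0] W] by (elim bexE conjE)
    have "uncountable {i \<in> I. K i \<subseteq> V}"
      using good[OF V(1,2)] V(1) unfolding bad_def by simp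
    moreover have "{i \<in> I. K i \<subseteq> V} \<subseteq> S n"
      unfolding S_def using V(3) by auto
    ultimately show ?thesis
      using countable_finite countable_subset by blast
  qed
  then obtain j where j: "inj j" "\<And>n. j n \<in> S n"
    using inj_choice_from_infinite_sets by blast
  have jI: "j n \<in> I" for n
    using j(2) S_def by blast
  have "\<exists>N. \<forall>n\<ge>N. K (j n) \<subseteq> U" if U: "openin X U" "K i0 \<subseteq> U" for U
  proof -
    obtain W where "W \<in> \<N>" "W \<subseteq> U"
      using \<W>(3)[OF K[OF i0] U] unfolding \<N>_def by blast
    then obtain m where m: "w m \<subseteq> U"
      using w by blast
    \<comment> \<open>The condition defining \<open>S n\<close> includes all earlier
      \<open>w m\<close>, so it persists along the tail.\<close>
    have "K (j n) \<subseteq> U" if "n \<ge> m" for n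
      using j(2)[of n] that m unfolding S_def by blast
    then show ?thesis by blast
  qed
  then have "compactin X (K i0 \<union> (\<Union>n. K (j n)))"
    using K i0 jI by (intro compactin_Un_upper_convergent_sequence) auto
  then show thesis
    using that[of j "K i0 \<union> (\<Union>n. K (j n))"] j(1) jI by blast
qed

section \<open>Compact-open neighbourhoods and uniform balls on compact sets\<close>

context Metric_space
begin

text \<open>Induction on the generation of the topology: intersections are handled by the union of
  the compact sets and the smaller radius, subbasic sets by a Lebesgue number.\<close>

lemma openin_compact_open_contains_uniform_ball:
  assumes "openin (compact_open_topology X mtopology) U" "f \<in> U"
  shows "\<exists>K \<epsilon>. compactin X K \<and> \<epsilon> > 0 \<and>
           {g \<in> continuous_maps X mtopology. \<forall>x\<in>K. d (f x) (g x) < \<epsilon>} \<subseteq> U"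
proof -
  let ?B = "\<lambda>K \<epsilon>. {g \<in> continuous_maps X mtopology. \<forall>x\<in>K. d (f x) (g x) < \<epsilon>}"
  have "f \<in> continuous_maps X mtopology"
    using assms openin_subset topspace_compact_open_topology by blast
  then have f: "continuous_map X mtopology f"
    by (simp add: continuous_maps_def)
  have "generate_topology_on
      {{f \<in> continuous_maps X mtopology. f ` K \<subseteq> U} | K U. compactin X K \<and> openin mtopology U} U"
    using assms(1) unfolding compact_open_topology_def by (rule openin_topology_generated_by)
  then show ?thesis
    using assms(2)
  proof induction
    case Empty
    then show ?case by simp
  next
    case (Int a b)
    then obtain K \<epsilon> L \<delta> where *: "compactin X K" "\<epsilon> > 0" "?B K \<epsilon> \<subseteq> a"
      "compactin X L" "\<delta> > 0" "?B L \<delta> \<subseteq> b"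
      by blast
    then have "?B (K \<union> L) (min \<epsilon> \<delta>) \<subseteq> a \<inter> b"
      by (auto simp: subset_iff)
    moreover have "compactin X (K \<union> L)" "min \<epsilon> \<delta> > 0"
      using * by (auto intro: compactin_Un)
    ultimately show ?case
      by (intro exI conjI)
  next
    case (UN \<K>)
    then obtain k where "k \<in> \<K>" "f \<in> k"
      by blast
    with UN.IH obtain K \<epsilon> where "compactin X K" "\<epsilon> > 0" "?B K \<epsilon> \<subseteq> k"
      by blast
    with \<open>k \<in> \<K>\<close> show ?case
      by (intro exI conjI) (assumption | rule Sup_upper2)+
  next
    case (Basis s)
    then obtain K V where s: "s = {f \<in> continuous_maps X mtopology. f ` K \<subseteq> V}"
      and K: "compactin X K" and V: "openin mtopology V"
      by blast
    have "f ` K \<subseteq> V"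
      using Basis.prems s by blast
    \<comment> \<open>The Lebesgue number of the one-element cover \<open>{V}\<close> is a radius
      that works at all points of the compact image simultaneously.\<close>
    then obtain \<epsilon> where \<epsilon>: "\<epsilon> > 0" "\<forall>y\<in>f ` K. mball y \<epsilon> \<subseteq> V"
      using lebesgue_number[OF image_compactin[OF K f], of "{V}"] V by auto
    have "g x \<in> V" if "g \<in> ?B K \<epsilon>" "x \<in> K" for g x
    proof -
      have "x \<in> topspace X"
        using K that(2) compactin_subset_topspace by blast
      then have "f x \<in> M" "g x \<in> M"
        using f that(1) by (auto simp: continuous_maps_def continuous_map_def Pi_iff)
      then show ?thesis
        using \<epsilon>(2) that by (auto simp: subset_iff)
    qed
    then have "?B K \<epsilon> \<subseteq> s"
      unfolding s by blast
    with K \<epsilon>(1) show ?case by blast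
  qed
qed

text \<open>\<open>K\<close> is cut into finitely many compact pieces on which \<open>f\<close> is
  nearly constant; a subbasic condition on each piece then controls \<open>g\<close> on all of
  \<open>K\<close>.\<close>

lemma uniform_ball_contains_openin_compact_open:
  assumes f: "f \<in> continuous_maps X mtopology" and K: "compactin X K" and \<epsilon>: "\<epsilon> > 0"
  shows "\<exists>U. openin (compact_open_topology X mtopology) U \<and> f \<in> U \<and>
           U \<subseteq> {g \<in> continuous_maps X mtopology. \<forall>x\<in>K. d (f x) (g x) < \<epsilon>}"
proof -
  have fc: "continuous_map X mtopology f"
    using f by (simp add: continuous_maps_def)
  have fM: "f x \<in> M" if "x \<in> K" for x
    using that K fc compactin_subset_topspace
    by (fastforce simp: continuous_map_def Pi_iff)
  have "f ` K \<subseteq> \<Union>((\<lambda>x. mball (f x) (\<epsilon>/4)) ` K)"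
    using fM \<epsilon> by force
  then obtain \<F> where \<F>: "finite \<F>" "\<F> \<subseteq> (\<lambda>x. mball (f x) (\<epsilon>/4)) ` K" "f ` K \<subseteq> \<Union>\<F>"
    using compactinD[OF image_compactin[OF K fc], of "(\<lambda>x. mball (f x) (\<epsilon>/4)) ` K"] by blast
  then obtain F where F: "F \<subseteq> K" "finite F" "\<F> = (\<lambda>x. mball (f x) (\<epsilon>/4)) ` F"
    by (meson finite_subset_image)
  \<comment> \<open>Closed balls keep the pieces compact, and the radius \<open>\<epsilon>/4\<close>
    keeps \<open>f\<close> itself inside the open ball of radius \<open>\<epsilon>/2\<close> that
    defines \<open>N x\<close>.\<close>
  define P where "P x = K \<inter> {z \<in> topspace X. f z \<in> mcball (f x) (\<epsilon>/4)}" for x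
  define N where "N x = {g \<in> continuous_maps X mtopology. g ` P x \<subseteq> mball (f x) (\<epsilon>/2)}" for x
  have "compactin X (P x)" for x
    unfolding P_def
    by (intro compact_Int_closedin K closedin_continuous_map_preimage[OF fc] closedin_mcball)
  then have N: "openin (compact_open_topology X mtopology) (N x)" for x
    unfolding compact_open_topology_def openin_topology_generated_by_iff N_def
    by (intro generate_topology_on.Basis) blast
  have fN: "f \<in> N x" for x
    using f \<epsilon> by (auto simp: N_def P_def)
  \<comment> \<open>The topspace is included because the intersection over an empty \<open>F\<close>
    would be \<open>UNIV\<close>.\<close>
  define U where "U = topspace (compact_open_topology X mtopology) \<inter> \<Inter>(N ` F)"
  have "openin (compact_open_topology X mtopology) U"
    unfolding U_def using F(2) N
    by (cases "F = {}") (auto simp del: topspace_compact_open_topology)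
  moreover have "f \<in> U"
    using f fN by (simp add: U_def)
  moreover have "d (f z) (g z) < \<epsilon>" if g: "g \<in> U" and z: "z \<in> K" for g z
  proof -
    obtain x where x: "x \<in> F" "f z \<in> mball (f x) (\<epsilon>/4)"
      using \<F>(3) F(3) z by blast
    then have "z \<in> P x"
      using z K compactin_subset_topspace by (fastforce simp: P_def)
    then have "g z \<in> mball (f x) (\<epsilon>/2)"
      using g x(1) unfolding U_def N_def by blast
    \<comment> \<open>The distance is below \<open>\<epsilon>/4 + \<epsilon>/2\<close>, passing
      through \<open>f x\<close>.\<close>
    with x(2) show ?thesis
      using triangle'[of "f z" "f x" "g z"] \<epsilon> by (auto simp: commute)
  qed
  ultimately show ?thesis
    by (intro exI[of _ U]) (auto simp: U_def)
qed

lemma P_omega1_omega_space_compact_open: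
  assumes X: "second_countable X"
  shows "P_omega1_omega_space (compact_open_topology X mtopology)"
  unfolding P_omega1_omega_space_def P_omega1_omega_point_def
proof (intro ballI allI impI)
  let ?Z = "compact_open_topology X mtopology"
  fix f \<U>
  let ?B = "\<lambda>K \<epsilon>. {g \<in> continuous_maps X mtopology. \<forall>x\<in>K. d (f x) (g x) < \<epsilon>}"
  assume f: "f \<in> topspace ?Z" and \<U>: "uncountable \<U> \<and> (\<forall>N\<in>\<U>. neighbourhood_in ?Z f N)"
  \<comment> \<open>Restricting the radii to the values \<open>1/(n+1)\<close> leaves countably many
    classes, one of which must be uncountable.\<close>
  have "\<exists>K n. compactin X K \<and> ?B K (inverse (real (Suc n))) \<subseteq> N" if N: "N \<in> \<U>" for N
  proof -
    obtain U where "openin ?Z U" "f \<in> U" "U \<subseteq> N"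
      using \<U> N unfolding neighbourhood_in_def by blast
    with openin_compact_open_contains_uniform_ball[of X U f]
    obtain K \<epsilon> where K: "compactin X K" "\<epsilon> > 0" "?B K \<epsilon> \<subseteq> N"
      by (meson order.trans)
    obtain n where "inverse (real (Suc n)) < \<epsilon>"
      using reals_Archimedean K(2) by blast
    then have "?B K (inverse (real (Suc n))) \<subseteq> ?B K \<epsilon>"
      by fastforce
    with K(3) have "?B K (inverse (real (Suc n))) \<subseteq> N"
      by (rule order.trans[rotated])
    with K(1) show ?thesis by blast
  qed
  then have "\<forall>N\<in>\<U>. \<exists>K n. compactin X K \<and> ?B K (inverse (real (Suc n))) \<subseteq> N"
    by blast
  from bchoice[OF this] obtain K where
    "\<forall>N\<in>\<U>. \<exists>n. compactin X (K N) \<and> ?B (K N) (inverse (real (Suc n))) \<subseteq> N" ..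
  from bchoice[OF this] obtain n where
    "\<forall>N\<in>\<U>. compactin X (K N) \<and> ?B (K N) (inverse (real (Suc (n N)))) \<subseteq> N" ..
  then have Kn: "\<And>N. N \<in> \<U> \<Longrightarrow> compactin X (K N)"
    "\<And>N. N \<in> \<U> \<Longrightarrow> ?B (K N) (inverse (real (Suc (n N)))) \<subseteq> N"
    by simp_all
  have "\<exists>m. uncountable {N \<in> \<U>. n N = m}"
  proof (rule ccontr)
    assume "\<nexists>m. uncountable {N \<in> \<U>. n N = m}"
    then have "countable (\<Union>m. {N \<in> \<U>. n N = m})"
      by (intro countable_UN) auto
    moreover have "(\<Union>m. {N \<in> \<U>. n N = m}) = \<U>"
      by auto
    ultimately show False
      using \<U> by simp
  qed
  then obtain m where m: "uncountable {N \<in> \<U>. n N = m}" ..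
  have "compactin X (K N)" if "N \<in> {N \<in> \<U>. n N = m}" for N
    using Kn(1) that by simp
  \<comment> \<open>The neighbourhoods themselves serve as indices, so the injectivity of
    \<open>j\<close> yields infinitely many distinct members of \<open>\<U>\<close>.\<close>
  from uncountable_compact_family_sequence[OF X m, of K, OF this]
  obtain j :: "nat \<Rightarrow> ('b \<Rightarrow> 'a) set" and L
    where j: "inj j" "range j \<subseteq> {N \<in> \<U>. n N = m}"
      and L: "compactin X L" "\<And>i. K (j i) \<subseteq> L"
    by metis
  have "?B L (inverse (real (Suc m))) \<subseteq> j i" for i
  proof -
    have "j i \<in> \<U>" "n (j i) = m"
      using j(2) by blast+
    then have "?B (K (j i)) (inverse (real (Suc m))) \<subseteq> j i"
      using Kn(2)[of "j i"] by simp
    \<comment> \<open>Enlarging the compact set shrinks the ball, so the single ball over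
      \<open>L\<close> fits into every \<open>j i\<close>.\<close>
    moreover have "?B L (inverse (real (Suc m))) \<subseteq> ?B (K (j i)) (inverse (real (Suc m)))"
      using L(2)[of i] by auto
    ultimately show ?thesis
      by (rule order.trans[rotated])
  qed
  then have "?B L (inverse (real (Suc m))) \<subseteq> \<Inter>(range j)"
    by blast
  moreover obtain U where "openin ?Z U" "f \<in> U" "U \<subseteq> ?B L (inverse (real (Suc m)))"
    using uniform_ball_contains_openin_compact_open[OF _ L(1), of f "inverse (real (Suc m))"] f
    by auto
  moreover have "\<Inter>(range j) \<subseteq> topspace ?Z"
    using j(2) \<U> unfolding neighbourhood_in_def by blast
  ultimately have "neighbourhood_in ?Z f (\<Inter>(range j))"
    unfolding neighbourhood_in_def by blast
  moreover have "infinite (range j)"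
    using j(1) finite_imageD by blast
  ultimately show "\<exists>\<V>. \<V> \<subseteq> \<U> \<and> countable \<V> \<and> infinite \<V> \<and> neighbourhood_in ?Z f (\<Inter>\<V>)"
    using j(2) by (intro exI[of _ "range j"]) auto
qed

end

theorem theorem1p6:
  fixes X :: "'a topology" and Y :: "'b topology"
  assumes "separable_space X" and "metrizable_space X" and "metrizable_space Y"
  shows "P_omega1_omega_space (compact_open_topology X Y)"
proof -
  obtain M d where "Metric_space M d" "Y = Metric_space.mtopology M d"
    using assms(3) metrizable_space_def by blast
  then show ?thesis
    using Metric_space.P_omega1_omega_space_compact_open
      separable_metrizable_imp_second_countable[OF assms(1,2)] by blast
qed

end
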